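(* Let $A\subset\mathbb{R}^m$ be a finite nonempty set, $z^+\in\mathbb{R}^m$, and $\rho$ a nonnegative weight density on $\Delta^{m-1}$. Fix a candidate $x$ and assume that the scalarized achievement process is modelled directly by Gaussian marginals $Z_x(\lambda)\sim N(m_x(\lambda),s_x^2(\lambda))$, $s_x(\lambda)>0$, $\lambda\in\Delta^{m-1}$. Then $$\mathrm{ER2I}_A(x)=\int_{\Delta^{m-1}}\mathrm{EI}\bigl(h_A(\lambda);m_x(\lambda),s_x(\lambda)\bigr)\,\rho(\lambda)\,d\sigma(\lambda),$$ where $$\mathrm{EI}(c;\mu,s)=(c-\mu)\,\Phi\!\left(\frac{c-\mu}{s}\right)+s\,\varphi\!\left(\frac{c-\mu}{s}\right).$$
   Context: $\Delta^{m-1}=\{\lambda\in\mathbb{R}_+^m:\sum_i\lambda_i=1\}$ with surface (Lebesgue) measure $\sigma$; $\rho:\Delta^{m-1}\to[0,\infty)$ is integrable. $g_\lambda(y;z^+)=\max_i\lambda_i(y_i-z_i^+)$ and $h_A(\lambda)=\min_{a\in A}g_\lambda(a;z^+)$. The expected $R_2$ improvement is $\mathrm{ER2I}_A(x)=\int_{\Delta^{m-1}}\mathbb{E}[\Delta_\lambda]\,\rho(\lambda)\,d\sigma(\lambda)$, where $\Delta_\lambda$ is the improvement of the envelope at $\lambda$ by the candidate. When the achievement process is modelled directly, $Z_x(\lambda)$ plays the role of the random achievement value $g_\lambda(Y(x);z^+)$ of the candidate's random objective vector $Y(x)$, so $\Delta_\lambda=(h_A(\lambda)-Z_x(\lambda))_+$,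 with $(u)_+=\max\{u,0\}$. The functions $\lambda\mapsto m_x(\lambda)$ and $\lambda\mapsto s_x(\lambda)$ are measurable, and integrals of nonnegative functions are taken in $[0,\infty]$. $\Phi,\varphi$ are the standard normal distribution function and density. *)

theory Defs
  imports "HOL-Probability.Probability"
begin

definition std_simplex :: "(real ^ 'm) set" where
  "std_simplex = {w. (\<forall>i. 0 \<le> w $ i) \<and> (\<Sum>i\<in>UNIV. w $ i) = 1}"

text \<open>
  Surface measure on the simplex. Let \<open>u\<close> be the unit normal of the hyperplane
  \<open>H = {y. (\<Sum>i. y\<^sub>i) = 1}\<close>. Every point is uniquely \<open>b + t u\<close> with \<open>b \<in> H\<close> and
  \<open>t\<close> its signed distance to \<open>H\<close>. In orthonormal coordinates adapted to \<open>H\<close>, Lebesgue measure is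
  the product of \<open>(m-1)\<close>-dimensional Lebesgue measure on \<open>H\<close> and \<open>dt\<close>, so the surface measure of
  \<open>B \<subseteq> H\<close> is the \<open>m\<close>-dimensional volume of the right prism of height \<open>1\<close> over \<open>B\<close>, i.e. the
  surface measure is the image of Lebesgue measure on the slab \<open>0 \<le> t \<le> 1\<close> under orthogonal
  projection to \<open>H\<close> (see \<open>emeasure_simplex_measure\<close> below). This also covers \<open>m = 1\<close>, where it is
  the unit mass at the only point. The completion makes it a Lebesgue measure, so that
  measurability refers to Lebesgue rather than only to Borel sets.
\<close>

definition hyperplane_normal :: "real ^ 'm" where
  "hyperplane_normal = (\<chi> i. 1 / sqrt (real CARD('m)))"

definition hyperplane_dist :: "real ^ 'm \<Rightarrow> real" where
  "hyperplane_dist y = ((\<Sum>i\<in>UNIV. y $ i) - 1) / sqrt (real CARD('m))"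

definition hyperplane_proj :: "real ^ 'm \<Rightarrow> real ^ 'm" where
  "hyperplane_proj y = y - hyperplane_dist y *\<^sub>R hyperplane_normal"

definition simplex_measure :: "(real ^ 'm) measure" where
  "simplex_measure =
     completion
       (restrict_space
         (distr (restrict_space lborel {y. 0 \<le> hyperplane_dist y \<and> hyperplane_dist y \<le> 1})
           borel hyperplane_proj)
         std_simplex)"

definition achievement :: "real ^ 'm \<Rightarrow> real ^ 'm \<Rightarrow> real ^ 'm \<Rightarrow> real" where
  "achievement z w y = (MAX i\<in>UNIV. w $ i * (y $ i - z $ i))"

definition envelope :: "real ^ 'm \<Rightarrow> (real ^ 'm) set \<Rightarrow> real ^ 'm \<Rightarrow> real" where
  "envelope z A w = (MIN a\<in>A. achievement z w a)"

definition improvement :: "real \<Rightarrow> real \<Rightarrow> real" where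
  "improvement h v = max (h - v) 0"

text \<open>
  \<open>Z w\<close> is the random achievement value of the candidate at \<open>w\<close> on the probability space \<open>M\<close>.
\<close>

definition ER2I ::
  "real ^ 'm \<Rightarrow> (real ^ 'm \<Rightarrow> real) \<Rightarrow> (real ^ 'm) set \<Rightarrow> 'w measure \<Rightarrow> (real ^ 'm \<Rightarrow> 'w \<Rightarrow> real) \<Rightarrow> ennreal"
where
  "ER2I z \<rho> A M Z =
     (\<integral>\<^sup>+ w. (\<integral>\<^sup>+ \<omega>. ennreal (improvement (envelope z A w) (Z w \<omega>)) \<partial>M) * ennreal (\<rho> w)
        \<partial>simplex_measure)"

definition EI :: "real \<Rightarrow> real \<Rightarrow> real \<Rightarrow> real" where
  "EI c \<mu> s =
     (c - \<mu>) * cdf std_normal_distribution ((c - \<mu>) / s) + s * std_normal_density ((c - \<mu>) / s)"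

lemma closed_simplex: "closed (std_simplex :: (real ^ 'm) set)"
proof -
  have eq: "std_simplex = (\<Inter>i. {w :: real ^ 'm. 0 \<le> w $ i}) \<inter> {w. (\<Sum>i\<in>UNIV. w $ i) = 1}"
    by (auto simp: std_simplex_def)
  show ?thesis
    unfolding eq
    by (intro closed_Int closed_INT ballI closed_Collect_le closed_Collect_eq continuous_intros)
qed

lemma space_simplex_measure [simp]: "space (simplex_measure :: (real ^ 'm) measure) = std_simplex"
  by (simp add: simplex_measure_def space_restrict_space)

lemma continuous_hyperplane_dist: "continuous_on UNIV (hyperplane_dist :: real ^ 'm \<Rightarrow> real)"
  unfolding hyperplane_dist_def[abs_def] by (intro continuous_intros) auto

lemma continuous_hyperplane_proj: "continuous_on UNIV (hyperplane_proj :: real ^ 'm \<Rightarrow> real ^ 'm)"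
  unfolding hyperplane_proj_def[abs_def] by (intro continuous_intros continuous_hyperplane_dist)

lemma sum_hyperplane_normal:
  "(\<Sum>i\<in>UNIV. (hyperplane_normal :: real ^ 'm) $ i) = sqrt (real CARD('m))"
  by (simp add: hyperplane_normal_def real_div_sqrt)

lemma hyperplane_dist_prism:
  assumes "(\<Sum>i\<in>UNIV. b $ i) = 1"
  shows "hyperplane_dist (b + t *\<^sub>R hyperplane_normal :: real ^ 'm) = t"
  using assms sum_hyperplane_normal[where 'm = 'm]
  by (simp add: hyperplane_dist_def sum.distrib sum_distrib_left[symmetric])

lemma emeasure_simplex_measure:
  fixes B :: "(real ^ 'm) set"
  assumes B: "B \<in> sets borel" "B \<subseteq> std_simplex"
  shows "emeasure simplex_measure B =
    emeasure lborel {b + t *\<^sub>R hyperplane_normal | b t. b \<in> B \<and> 0 \<le> t \<and> t \<le> 1}"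
proof -
  let ?S = "{y :: real ^ 'm. 0 \<le> hyperplane_dist y \<and> hyperplane_dist y \<le> 1}"
  let ?L = "restrict_space lborel ?S"
  let ?D = "distr ?L borel hyperplane_proj"
  have [measurable]: "hyperplane_dist \<in> borel_measurable (borel :: (real ^ 'm) measure)"
    "hyperplane_proj \<in> borel_measurable (borel :: (real ^ 'm) measure)"
    using continuous_hyperplane_dist continuous_hyperplane_proj
    by (auto intro: borel_measurable_continuous_onI)
  have S: "?S \<in> sets borel" by measurable
  have sx: "std_simplex \<in> sets (borel :: (real ^ 'm) measure)"
    using closed_simplex by (rule borel_closed)
  have proj: "hyperplane_proj \<in> measurable ?L borel"
    by (rule measurable_restrict_space1) simp
  have "B \<in> sets (restrict_space ?D std_simplex)"
    using B sx by (auto simp: sets_restrict_space_iff)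
  then have "emeasure simplex_measure B = emeasure (restrict_space ?D std_simplex) B"
    by (simp add: simplex_measure_def)
  also have "\<dots> = emeasure ?D B"
    using B sx by (intro emeasure_restrict_space) auto
  also have "\<dots> = emeasure ?L (hyperplane_proj -` B \<inter> ?S)"
    using B proj by (subst emeasure_distr) (auto simp: space_restrict_space)
  also have "\<dots> = emeasure lborel (hyperplane_proj -` B \<inter> ?S)"
    using S by (intro emeasure_restrict_space) auto
  also have "hyperplane_proj -` B \<inter> ?S =
      {b + t *\<^sub>R hyperplane_normal | b t. b \<in> B \<and> 0 \<le> t \<and> t \<le> 1}" (is "?l = ?r")
  proof
    show "?l \<subseteq> ?r"
    proof
      fix y assume y: "y \<in> ?l"
      have "y = hyperplane_proj y + hyperplane_dist y *\<^sub>R hyperplane_normal"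
        by (simp add: hyperplane_proj_def)
      with y show "y \<in> ?r" by blast
    qed
    show "?r \<subseteq> ?l"
    proof
      fix y assume "y \<in> ?r"
      then obtain b t where y: "y = b + t *\<^sub>R hyperplane_normal" "b \<in> B" "0 \<le> t" "t \<le> 1"
        by blast
      have "hyperplane_dist y = t"
        using B y by (auto simp: std_simplex_def intro!: hyperplane_dist_prism)
      with y show "y \<in> ?l" by (simp add: hyperplane_proj_def)
    qed
  qed
  finally show ?thesis .
qed

end

theory Submission
  imports Defs "HOL-Real_Asymp.Real_Asymp"
begin

text \<open>
  The two sides are integrals over the simplex against the same measure, and their integrands agree
  at every point: the weight \<open>\<rho> w\<close> is common, so all that has to be shown is that a Gaussian
  variable \<open>X \<sim> N(\<mu>, s\<^sup>2)\<close> satisfies \<open>E (c - X)\<^sub>+ = EI c \<mu> s\<close>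
  (\<open>nn_integral_improvement_normal\<close>). At a fixed \<open>w\<close> the envelope is just
  the constant \<open>c\<close>.

  For the one-dimensional identity, write \<open>X = \<mu> + s U\<close> with \<open>U\<close> standard normal and
  \<open>d = (c - \<mu>) / s\<close>. Then \<open>(c - X)\<^sub>+ = s (d - U)\<^sub>+\<close>, and
  \<open>E (d - U)\<^sub>+ = d P(U \<le> d) - E (U; U \<le> d)\<close>. The first term is \<open>d \<Phi>(d)\<close>; the second is
  computed in \<open>std_normal_partial_mean\<close> from the differential equation
  \<open>\<phi>' u = - u \<phi> u\<close>.
\<close>

lemma has_real_derivative_std_normal_density:
  "(std_normal_density has_real_derivative - (std_normal_density u * u)) (at u)"
  unfolding std_normal_density_def[abs_def]
  by (auto intro!: derivative_eq_intros simp: field_simps)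

lemma continuous_std_normal_density: "isCont std_normal_density u"
  using has_real_derivative_std_normal_density by (rule DERIV_isCont)

text \<open>
  The integrand is the derivative of \<open>- std_normal_density\<close>, which vanishes at \<open>-\<infinity>\<close>, so
  only the boundary term at \<open>d\<close> survives.
\<close>

lemma std_normal_partial_mean:
  "(\<integral>u. indicator {..d} u * (std_normal_density u * u) \<partial>lborel) = - std_normal_density d"
proof -
  have int: "integrable lborel (\<lambda>u. std_normal_density u * u)"
    using integrable_std_normal_moment[of 1] by simp
  have "(LBINT u=-\<infinity>..ereal d. std_normal_density u * u) = - std_normal_density d - 0"
  proof (rule interval_integral_FTC_integrable[where F = "\<lambda>u. - std_normal_density u"])
    show "((\<lambda>u. - std_normal_density u) has_vector_derivative std_normal_density u * u) (at u)"
      for u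
      using DERIV_minus[OF has_real_derivative_std_normal_density[of u]]
      by (simp add: has_real_derivative_iff_has_vector_derivative)
    show "isCont (\<lambda>u. std_normal_density u * u) u" for u
      by (intro continuous_intros continuous_std_normal_density)
    show "set_integrable lborel (einterval (-\<infinity>) (ereal d)) (\<lambda>u. std_normal_density u * u)"
      unfolding set_integrable_def by (intro integrable_mult_indicator int) simp
    have "((\<lambda>u. - std_normal_density u) \<longlongrightarrow> 0) at_bot"
      unfolding std_normal_density_def by real_asymp
    then show "(((\<lambda>u. - std_normal_density u) \<circ> real_of_ereal) \<longlongrightarrow> 0) (at_right (-\<infinity>))"
      by (simp add: ereal_tendsto_simps)
    have "((\<lambda>u. - std_normal_density u) \<longlongrightarrow> - std_normal_density d) (at_left d)"
      using continuous_std_normal_density[of d]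
      by (intro tendsto_minus) (auto simp: isCont_def intro: filterlim_mono[OF _ order_refl at_le])
    then show "(((\<lambda>u. - std_normal_density u) \<circ> real_of_ereal) \<longlongrightarrow> - std_normal_density d)
        (at_left (ereal d))"
      by (simp add: ereal_tendsto_simps)
  qed simp
  moreover have "(LBINT u=-\<infinity>..ereal d. std_normal_density u * u) =
      (\<integral>u. indicator {..d} u * (std_normal_density u * u) \<partial>lborel)"
    \<comment> \<open>The interval integral runs over the open half-line; the endpoint is a null set.\<close>
    unfolding interval_lebesgue_integral_def set_lebesgue_integral_def
    using AE_lborel_singleton[of d]
    by (auto intro!: integral_cong_AE simp: einterval_def split: split_indicator)
  ultimately show ?thesis by simp
qed

text \<open>
  On \<open>{..d}\<close>, where alone the integrand is nonzero, the factor \<open>d - u\<close> splits the integral into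
  \<open>d\<close> times a probability and a partial mean. Integrability is part of the conclusion so that the
  value transfers to the integral in \<open>[0, \<infinity>]\<close>.
\<close>

lemma has_bochner_integral_improvement_std_normal:
  "has_bochner_integral lborel (\<lambda>u. std_normal_density u * max (d - u) 0)
    (d * cdf std_normal_distribution d + std_normal_density d)"
proof -
  let ?p = "\<lambda>u. indicator {..d} u * std_normal_density u"
  let ?q = "\<lambda>u. indicator {..d} u * (std_normal_density u * u)"
  have p: "integrable lborel ?p"
    using integrable_mult_indicator[of "{..d}" lborel std_normal_density] by simp
  have q: "integrable lborel ?q"
    using integrable_mult_indicator[of "{..d}" lborel "\<lambda>u. std_normal_density u * u"]
      integrable_std_normal_moment[of 1] by simp
  have "emeasure std_normal_distribution {..d} = (\<integral>\<^sup>+u. ennreal (?p u) \<partial>lborel)"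
    by (subst emeasure_density) (auto intro!: nn_integral_cong split: split_indicator)
  also have "\<dots> = ennreal (\<integral>u. ?p u \<partial>lborel)"
    using p by (rule nn_integral_eq_integral) simp
  finally have "cdf std_normal_distribution d = (\<integral>u. ?p u \<partial>lborel)"
    by (simp add: cdf_def measure_def)
  then have "has_bochner_integral lborel (\<lambda>u. d * ?p u - ?q u)
      (d * cdf std_normal_distribution d - - std_normal_density d)"
    using p q std_normal_partial_mean[of d]
    by (intro has_bochner_integral_diff has_bochner_integral_mult_right)
       (auto simp: has_bochner_integral_iff)
  moreover have "(\<lambda>u. d * ?p u - ?q u) = (\<lambda>u. std_normal_density u * max (d - u) 0)"
    by (auto simp: fun_eq_iff algebra_simps split: split_indicator)
  ultimately show ?thesis by simp
qed

lemma (in prob_space) nn_integral_improvement_normal: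
  assumes X: "distributed M lborel X (normal_density \<mu> s)" and s: "0 < s"
  shows "(\<integral>\<^sup>+ \<omega>. ennreal (improvement c (X \<omega>)) \<partial>M) = ennreal (EI c \<mu> s)"
proof -
  define d where "d = (c - \<mu>) / s"
  let ?U = "\<lambda>\<omega>. (X \<omega> - \<mu>) / s"
  note I = has_bochner_integral_improvement_std_normal[of d]
  have U: "distributed M lborel ?U std_normal_density"
    using normal_standard_normal_convert[OF s, of X \<mu>] X by simp
  have "improvement c (X \<omega>) = s * max (d - ?U \<omega>) 0" for \<omega>
    using s by (auto simp: improvement_def d_def max_def field_simps)
  then have "(\<integral>\<^sup>+ \<omega>. ennreal (improvement c (X \<omega>)) \<partial>M) =
      (\<integral>\<^sup>+ \<omega>. ennreal (s * max (d - ?U \<omega>) 0) \<partial>M)"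
    by simp
  also have "\<dots> = (\<integral>\<^sup>+ u. ennreal (std_normal_density u) * ennreal (s * max (d - u) 0) \<partial>lborel)"
    by (rule distributed_nn_integral[OF U, symmetric]) measurable
  also have "\<dots> = (\<integral>\<^sup>+ u. ennreal (s * (std_normal_density u * max (d - u) 0)) \<partial>lborel)"
    using s by (intro nn_integral_cong) (simp add: ennreal_mult[symmetric] mult.left_commute)
  also have "\<dots> = ennreal (s * (d * cdf std_normal_distribution d + std_normal_density d))"
    using has_bochner_integral_mult_right[OF I, of s] s
    by (subst nn_integral_eq_integral) (auto simp: has_bochner_integral_iff)
  also have "s * (d * cdf std_normal_distribution d + std_normal_density d) = EI c \<mu> s"
    using s by (simp add: EI_def d_def distrib_left)
  finally show ?thesis .
qed

theorem theorem7p1: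
  fixes A :: "(real ^ 'm) set"
    and z :: "real ^ 'm"
    and \<rho> :: "real ^ 'm \<Rightarrow> real"
    and x :: 'x
    and M :: "'w measure"
    and Z :: "'x \<Rightarrow> real ^ 'm \<Rightarrow> 'w \<Rightarrow> real"
    and m s :: "'x \<Rightarrow> real ^ 'm \<Rightarrow> real"
  assumes "finite A" and "A \<noteq> {}"
    and "\<And>w. w \<in> std_simplex \<Longrightarrow> 0 \<le> \<rho> w"
    and "integrable simplex_measure \<rho>"
    and "prob_space M"
    and "m x \<in> borel_measurable simplex_measure"
    and "s x \<in> borel_measurable simplex_measure"
    and "\<And>w. w \<in> std_simplex \<Longrightarrow> 0 < s x w"
    and "\<And>w. w \<in> std_simplex \<Longrightarrow> distributed M lborel (Z x w) (normal_density (m x w) (s x w))"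
  shows "ER2I z \<rho> A M (Z x) =
    (\<integral>\<^sup>+ w. ennreal (EI (envelope z A w) (m x w) (s x w)) * ennreal (\<rho> w) \<partial>simplex_measure)"
proof -
  interpret prob_space M by fact
  show ?thesis
    unfolding ER2I_def
    by (intro nn_integral_cong) (simp add: nn_integral_improvement_normal[OF assms(9,8)])
qed

end
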